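(* Let $T$ be a (finite) tree of order $n$ (that is, with $n$ vertices) and diameter at least $2$. If $md(T) < \infty$, then $md(T) \leq n-2$.
   Context: All graphs are finite, simple and connected. For vertices $u,v$ of a graph $G$, $d(u,v)$ is the length (number of edges) of a shortest path between them, and the diameter of $G$ is the maximum of $d(u,v)$ over all pairs of vertices. For a set $W \subseteq V(G)$ and a vertex $v$, the representation multiset $r_m(v|W)$ is the multiset of the distances $d(v,w)$, $w \in W$ (counted with multiplicity; if $v\in W$, the distance $0$ is included). $W$ is an m-resolving set of $G$ if $r_m(u|W) \neq r_m(v|W)$ for every pair of distinct vertices $u,v \in V(G)$. If $G$ has an m-resolving set, the multiset dimension $md(G)$ is the cardinality of a smallest m-resolving set; otherwise $md(G)=\infty$. *)

theory Defs
  imports "Graph_Theory.Graph_Theory" "HOL-Library.Multiset" "HOL-Library.Extended_Nat"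
begin

text \<open>
  Finite simple graphs are the symmetric loop-free digraphs of the locale \<^locale>\<open>pair_graph\<close>: an
  edge \<open>uv\<close> is the pair of arcs \<open>(u, v)\<close> and \<open>(v, u)\<close>. Since \<open>parcs G\<close> is a relation, there
  are no parallel edges.
\<close>

definition gdist :: "'a pair_pre_digraph \<Rightarrow> 'a \<Rightarrow> 'a \<Rightarrow> nat" where
  "gdist G u v = (LEAST k. \<exists>p. pre_digraph.apath (with_proj G) u p v \<and> length p = k)"

definition diameter :: "'a pair_pre_digraph \<Rightarrow> nat" where
  "diameter G = Max {gdist G u v | u v. u \<in> pverts G \<and> v \<in> pverts G}"

text \<open>
  The predicate \<open>Digraph_Component.tree\<close> cannot be used here: in a symmetric digraph every edge
  gives the directed cycle \<open>u, v, u\<close> of length 2, which is not a cycle of the undirected graph.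
  The cycles of the undirected graph are the directed cycles of length at least 3.
\<close>

definition graph_tree :: "'a pair_pre_digraph \<Rightarrow> bool" where
  "graph_tree G \<longleftrightarrow> pair_graph G \<and> Digraph_Component.connected (with_proj G) \<and>
     \<not> (\<exists>p. pre_digraph.cycle (with_proj G) p \<and> 3 \<le> length p)"

definition rep_mset :: "'a pair_pre_digraph \<Rightarrow> 'a \<Rightarrow> 'a set \<Rightarrow> nat multiset" where
  "rep_mset G v W = image_mset (\<lambda>w. gdist G v w) (mset_set W)"

definition m_resolving :: "'a pair_pre_digraph \<Rightarrow> 'a set \<Rightarrow> bool" where
  "m_resolving G W \<longleftrightarrow> W \<subseteq> pverts G \<and>
     (\<forall>u\<in>pverts G. \<forall>v\<in>pverts G. u \<noteq> v \<longrightarrow> rep_mset G u W \<noteq> rep_mset G v W)"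

definition multiset_dim :: "'a pair_pre_digraph \<Rightarrow> enat" where
  "multiset_dim G =
     (if \<exists>W. m_resolving G W then enat (LEAST k. \<exists>W. m_resolving G W \<and> card W = k) else \<infinity>)"

text \<open>Agreement with the shortest-path cost of the library for unit weights.\<close>

lemma gdist_eq_unit_cost:
  assumes "pair_graph G" and "reachable (with_proj G) u v"
  shows "wf_digraph.\<mu> (with_proj G) (\<lambda>_. 1) u v = ereal (real (gdist G u v))"
proof -
  interpret pair_graph G by fact
  have cost: "awalk_cost (\<lambda>_. 1) p = real (length p)" for p :: "('a \<times> 'a) list"
    by (induction p) auto
  have "\<exists>p. apath u p v \<and> \<mu> (\<lambda>_. 1) u v = ereal (awalk_cost (\<lambda>_. 1) p)"
    using assms(2) by (intro no_neg_cyc_reach_imp_path) (auto simp: cost)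
  then obtain p where p: "apath u p v" "\<mu> (\<lambda>_. 1) u v = ereal (real (length p))"
    by (auto simp: cost)
  have "length p \<le> length q" if "apath u q v" for q
    using min_cost_le_walk_cost[of u q v "\<lambda>_. 1"] that p(2) by (auto simp: cost apath_def)
  then have "gdist G u v = length p"
    unfolding gdist_def using p(1) by (intro Least_equality) auto
  then show ?thesis using p(2) by simp
qed

end

theory Submission
  imports Defs
begin

text \<open>
  Given a resolving set \<open>W\<close> that misses at most one vertex, one has to be found that misses at
  least two. The point is that the distances from a vertex \<open>u\<close> to some well chosen vertices carry no
  information beyond what the largest distance from \<open>u\<close> to \<open>W\<close> tells anyway, so that these vertices
  can be removed from \<open>W\<close>.

  Let \<open>x\<close>, \<open>y\<close> be two elements of \<open>W\<close> at the largest possible distance. As in any tree, the vertex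
  of \<open>W\<close> farthest from a vertex \<open>u\<close> is reached by going to the midpoint of the path from \<open>x\<close> to \<open>y\<close>
  and then on to \<open>x\<close> or to \<open>y\<close> (\<open>centred_cases\<close>, \<open>Max_dist_vertex_centred\<close>,
  \<open>Max_dist_edge_centred\<close>). So the representation of \<open>u\<close> determines the distance of \<open>u\<close> to this
  midpoint, and this stays true if elements of \<open>W\<close> other than \<open>x\<close> and \<open>y\<close> are removed.

  If the midpoint is a vertex \<open>c\<close>, then \<open>c\<close> can be removed from \<open>W\<close>. If this leaves all other vertices,
  then all neighbours of \<open>c\<close> can be removed too: from a vertex at distance \<open>l\<close> of \<open>c\<close>, one of them is
  at distance \<open>l - 1\<close> and the others at distance \<open>l + 1\<close>, independently of the branch
  (\<open>rep_nbrs_eq\<close>). Only when \<open>x\<close> and \<open>y\<close> are themselves neighbours of \<open>c\<close> this is not possible; then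
  the tree is a star, and \<open>x\<close> and \<open>y\<close> are leaves in \<open>W\<close> with the same representation.

  If the midpoint is the middle of an edge \<open>cc'\<close>, then vertices at the same distance from the midpoint
  lie on the same side of the edge or on opposite sides, but in both cases see the pair \<open>c\<close>, \<open>c'\<close> at the
  same distances. If both \<open>c\<close> and \<open>c'\<close> belong to \<open>W\<close>, they can therefore be removed. Otherwise
  \<open>W\<close> is everything but, say, \<open>c\<close>. Removing \<open>c'\<close>, or all neighbours of \<open>c\<close>, does no harm to vertices on
  the same side. Vertices at the same distance from the midpoint but on opposite sides have different
  colours in the two-colouring of the tree, so that the even distances from them to a set \<open>U\<close> count
  the two colour classes of \<open>U\<close>: they can be confused only if these have equal size
  (\<open>balanced_if_opposite\<close>). Removing \<open>c'\<close> alone and removing all neighbours of \<open>c\<close> differ by vertices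
  of one colour, so at least one of the two results is not balanced. If \<open>x\<close> is itself a neighbour of
  \<open>c\<close>, the twin argument shows that the tree is a path on four vertices, which an end vertex resolves.
  If \<open>x\<close> and \<open>y\<close> are the ends of the edge and make up all of \<open>W\<close>, then the tree is a path on three
  vertices, also resolved by an end vertex, or has at least four vertices, and \<open>W\<close> is small enough.

  All of this uses only a few properties of the distance function of a tree, collected in the
  locale \<open>tree_metric\<close>.
\<close>

section \<open>The metric of a tree\<close>

text \<open>
  The last two assumptions are what is left of the absence of cycles: an edge joining two vertices
  equally far from \<open>u\<close>, and two different neighbours of \<open>c\<close> that are both closer to \<open>u\<close> than \<open>c\<close>,
  both close a cycle.
\<close>

locale tree_metric =
  fixes V :: "'a set" and d :: "'a \<Rightarrow> 'a \<Rightarrow> nat"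
  assumes finite_V: "finite V"
    and d_eq_0: "\<lbrakk>u \<in> V; v \<in> V\<rbrakk> \<Longrightarrow> d u v = 0 \<longleftrightarrow> u = v"
    and d_sym: "\<lbrakk>u \<in> V; v \<in> V\<rbrakk> \<Longrightarrow> d u v = d v u"
    and d_tri: "\<lbrakk>u \<in> V; v \<in> V; w \<in> V\<rbrakk> \<Longrightarrow> d u w \<le> d u v + d v w"
    and d_step: "\<lbrakk>u \<in> V; v \<in> V; u \<noteq> v\<rbrakk> \<Longrightarrow> \<exists>a\<in>V. d u a = 1 \<and> d u v = d a v + 1"
    and adj_neq: "\<lbrakk>a \<in> V; b \<in> V; u \<in> V; d a b = 1\<rbrakk> \<Longrightarrow> d a u \<noteq> d b u"
    and closer_unique: "\<lbrakk>a \<in> V; b \<in> V; c \<in> V; u \<in> V; d c a = 1; d c b = 1;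
      d c u = d a u + 1; d c u = d b u + 1\<rbrakk> \<Longrightarrow> a = b"
begin

lemma d_self [simp]: "u \<in> V \<Longrightarrow> d u u = 0"
  by (simp add: d_eq_0)

lemma adj_cases:
  assumes "a \<in> V" "b \<in> V" "u \<in> V" "d a b = 1"
  obtains "d a u = d b u + 1" | "d b u = d a u + 1"
proof -
  have "d a u \<noteq> d b u" using adj_neq assms by blast
  moreover have "d a u \<le> d a b + d b u" "d b u \<le> d b a + d a u" using assms d_tri by blast+
  moreover have "d b a = 1" using assms d_sym by simp
  ultimately show ?thesis using assms(4) that by linarith
qed

lemma farther_if_not_closer:
  assumes "a \<in> V" "b \<in> V" "c \<in> V" "u \<in> V" "d c a = 1" "d c b = 1" "a \<noteq> b"
    and "d c u = d b u + 1"
  shows "d a u = d c u + 1"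
  using adj_cases[OF assms(3,1,4,5)] closer_unique assms by metis

text \<open>
  A shortest path that starts by leaving \<open>u\<close> behind can never turn back, because at every vertex the
  only neighbour closer to \<open>u\<close> is the one that the path has just come from.
\<close>

lemma geodesic_through_edge:
  assumes "a \<in> V" "c \<in> V" "x \<in> V" "u \<in> V" "d c a = 1"
    and "d c x = d a x + 1" "d a u = d c u + 1"
  shows "d u x = d u c + d c x"
  using assms
proof (induction "d a x" arbitrary: a c)
  case 0
  then have "a = x" using d_eq_0 by metis
  then show ?case using 0 d_sym by (metis add.commute)
next
  case (Suc n)
  then have "a \<noteq> x" by auto
  then obtain b where b: "b \<in> V" "d a b = 1" "d a x = d b x + 1"
    using d_step Suc.prems by blast
  have ac: "d a c = 1" using Suc.prems d_sym by metis
  have "b \<noteq> c" using b Suc.prems by auto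
  then have "d b u = d a u + 1"
    using farther_if_not_closer[of b c a u] b ac Suc.prems by auto
  then have "d u x = d u a + d a x"
    using Suc.hyps(1)[of b a] Suc.hyps(2) b Suc.prems by auto
  then show ?case using Suc.prems d_sym by (metis add.assoc add.commute)
qed

text \<open>
  If \<open>c\<close> lies between \<open>x\<close> and \<open>y\<close>, then a vertex \<open>u\<close> sees at least one of them through \<open>c\<close>: the
  steps from \<open>c\<close> towards \<open>x\<close> and towards \<open>y\<close> go to different neighbours, and only one
  neighbour of \<open>c\<close> is closer to \<open>u\<close>.
\<close>

lemma between_cases:
  assumes "x \<in> V" "y \<in> V" "c \<in> V" "u \<in> V" "d x y = d x c + d c y"
  shows "d u x = d u c + d c x \<or> d u y = d u c + d c y"
proof (cases "c = x \<or> c = y \<or> u = c")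
  case True
  then show ?thesis using assms by auto
next
  case False
  obtain a where a: "a \<in> V" "d c a = 1" "d c x = d a x + 1"
    using d_step False assms by blast
  obtain b where b: "b \<in> V" "d c b = 1" "d c y = d b y + 1"
    using d_step False assms by blast
  have "a \<noteq> b"
  proof
    assume "a = b"
    moreover have "d x y \<le> d x a + d a y" using assms a d_tri by blast
    moreover have "d x a = d a x" "d x c = d c x" using assms a d_sym by blast+
    ultimately show False using a b assms(5) by simp
  qed
  then consider "d a u = d c u + 1" | "d b u = d c u + 1"
    using farther_if_not_closer[of a b c u] adj_cases[of c b u] assms a b by metis
  then show ?thesis
    using geodesic_through_edge[of a c x u] geodesic_through_edge[of b c y u] assms a b by cases auto
qed

text \<open>
  A tree is bipartite: the distance of two vertices is even if and only if they have the same colour,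
  the colour of a vertex being the parity of its distance to \<open>c\<close>.
\<close>

lemma even_d_iff:
  assumes "u \<in> V" "v \<in> V" "c \<in> V"
  shows "even (d u v) \<longleftrightarrow> (even (d u c) \<longleftrightarrow> even (d c v))"
  using assms
proof (induction "d u c" arbitrary: u)
  case 0
  then show ?case using d_eq_0 by auto
next
  case (Suc n)
  then have "u \<noteq> c" by auto
  then obtain a where a: "a \<in> V" "d u a = 1" "d u c = d a c + 1"
    using d_step Suc.prems by blast
  have "even (d a v) \<longleftrightarrow> (even (d a c) \<longleftrightarrow> even (d c v))"
    using Suc.hyps a Suc.prems by auto
  moreover have "even (d u v) \<longleftrightarrow> odd (d a v)"
    using adj_cases[of u a v] a Suc.prems by (metis even_add odd_one)
  ultimately show ?case using a by auto
qed

lemma point_at: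
  assumes "x \<in> V" "y \<in> V" "k \<le> d x y"
  shows "\<exists>c\<in>V. d x c = k \<and> d c y = d x y - k"
  using assms
proof (induction k arbitrary: x)
  case 0
  then show ?case by (intro bexI[of _ x]) auto
next
  case (Suc k)
  then have "x \<noteq> y" by auto
  then obtain a where a: "a \<in> V" "d x a = 1" "d x y = d a y + 1"
    using d_step Suc.prems by blast
  then obtain c where c: "c \<in> V" "d a c = k" "d c y = d a y - k"
    using Suc.IH[of a] Suc.prems by auto
  have "d x y \<le> d x c + d c y" "d x c \<le> d x a + d a c" using d_tri c a Suc.prems by blast+
  then show ?case using c a Suc.prems by (intro bexI[of _ c]) auto
qed

section \<open>Representations and resolving sets\<close>

definition rep :: "'a \<Rightarrow> 'a set \<Rightarrow> nat multiset" where
  "rep u W = image_mset (d u) (mset_set W)"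

definition resolving :: "'a set \<Rightarrow> bool" where
  "resolving W \<longleftrightarrow> W \<subseteq> V \<and> (\<forall>u\<in>V. \<forall>v\<in>V. rep u W = rep v W \<longrightarrow> u = v)"

lemma resolving_transfer:
  assumes "resolving W" "W' \<subseteq> V"
    and "\<And>u v. \<lbrakk>u \<in> V; v \<in> V; rep u W' = rep v W'\<rbrakk> \<Longrightarrow> rep u W = rep v W"
  shows "resolving W'"
  using assms unfolding resolving_def by blast

lemma rep_split:
  assumes "W \<subseteq> V" "S \<subseteq> W"
  shows "rep u W = rep u (W - S) + rep u S"
proof -
  have "finite W" using assms finite_V finite_subset by blast
  then have "mset_set ((W - S) \<union> S) = mset_set (W - S) + mset_set S"
    using assms finite_subset by (intro mset_set_Union) auto
  moreover have "(W - S) \<union> S = W" using assms by auto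
  ultimately show ?thesis unfolding rep_def by simp
qed

lemma rep_singleton [simp]: "rep u {w} = {#d u w#}"
  by (simp add: rep_def)

lemma rep_insert:
  assumes "insert w W \<subseteq> V" "w \<notin> W"
  shows "rep u (insert w W) = add_mset (d u w) (rep u W)"
  using assms finite_V finite_subset[of W V] by (simp add: rep_def)

lemma rep_cong:
  assumes "W \<subseteq> V" "\<And>w. w \<in> W \<Longrightarrow> d u w = d v w"
  shows "rep u W = rep v W"
  using assms finite_V finite_subset[of W V] unfolding rep_def by (intro image_mset_cong) auto

lemma rep_eq_image_eq:
  assumes "W \<subseteq> V" "rep u W = rep v W"
  shows "d u ` W = d v ` W"
  using arg_cong[OF assms(2), of set_mset] assms(1) finite_V finite_subset[of W V]
  by (simp add: rep_def)

text \<open>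
  By the pair \<open>{a, b}\<close> itself, both \<open>a\<close> and \<open>b\<close> are represented by the distances \<open>0\<close> and \<open>d a b\<close>.
\<close>

lemma twins_not_resolving:
  assumes "W \<subseteq> V" "a \<in> W" "b \<in> W" "a \<noteq> b"
    and "\<And>w. w \<in> W - {a, b} \<Longrightarrow> d a w = d b w"
  shows "\<not> resolving W"
proof -
  have "rep a W = rep a (W - {a, b}) + rep a {a, b}" "rep b W = rep b (W - {a, b}) + rep b {a, b}"
    using assms by (auto intro: rep_split)
  moreover have "rep a (W - {a, b}) = rep b (W - {a, b})" using assms by (intro rep_cong) auto
  moreover have "rep a {a, b} = rep b {a, b}"
  proof -
    have "a \<in> V" "b \<in> V" using assms by auto
    then show ?thesis using assms(4) rep_insert[of a "{b}"] d_sym[of a b] by simp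
  qed
  ultimately have "rep a W = rep b W" by simp
  then show ?thesis using assms unfolding resolving_def by blast
qed

definition nbrs :: "'a \<Rightarrow> 'a set" where
  "nbrs c = {a \<in> V. d c a = 1}"

text \<open>
  Exactly one neighbour of \<open>c\<close> is closer to \<open>u\<close>, so the representation of \<open>u\<close> by all neighbours of \<open>c\<close>
  depends only on the distance of \<open>u\<close> to \<open>c\<close>, not on the branch at \<open>c\<close> in which \<open>u\<close> lies.
\<close>

lemma rep_nbrs:
  assumes "c \<in> V" "u \<in> V" "u \<noteq> c"
  shows "rep u (nbrs c) = add_mset (d u c - 1) (replicate_mset (card (nbrs c) - 1) (d u c + 1))"
proof -
  obtain a where a: "a \<in> V" "d c a = 1" "d c u = d a u + 1" using d_step assms by metis
  have fin: "finite (nbrs c)" using finite_V by (simp add: nbrs_def)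
  have an: "a \<in> nbrs c" using a by (simp add: nbrs_def)
  have "d u w = d u c + 1" if "w \<in> nbrs c - {a}" for w
    using farther_if_not_closer[of w a c u] that a assms d_sym unfolding nbrs_def by auto
  then have "rep u (nbrs c - {a}) = image_mset (\<lambda>_. d u c + 1) (mset_set (nbrs c - {a}))"
    unfolding rep_def using fin by (intro image_mset_cong) auto
  also have "\<dots> = replicate_mset (card (nbrs c) - 1) (d u c + 1)"
    using an fin by (simp add: image_mset_const_eq)
  finally have "rep u (nbrs c - {a}) = replicate_mset (card (nbrs c) - 1) (d u c + 1)" .
  moreover have "rep u (nbrs c) = rep u (nbrs c - {a}) + rep u {a}"
    using an by (intro rep_split) (auto simp: nbrs_def)
  moreover have "d u a = d u c - 1" using a assms d_sym by auto
  ultimately show ?thesis by simp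
qed

lemma rep_nbrs_eq:
  assumes "c \<in> V" "u \<in> V" "v \<in> V" "d u c = d v c"
  shows "rep u (nbrs c) = rep v (nbrs c)"
  using assms rep_nbrs d_eq_0 by (metis)

section \<open>The centre of a set of vertices\<close>

text \<open>
  The set \<open>W\<close> lies in the ball of radius \<open>h\<close> around a vertex, or around the middle of an edge, and
  contains two antipodal points of this ball. Stated like this, and not through the diameter of \<open>W\<close>,
  the property is evidently kept when elements of \<open>W\<close> other than two such points are removed.
\<close>

definition vertex_centred :: "'a \<Rightarrow> nat \<Rightarrow> 'a set \<Rightarrow> bool" where
  "vertex_centred c h W \<longleftrightarrow> c \<in> V \<and> W \<subseteq> V \<and> (\<forall>w\<in>W. d w c \<le> h) \<and>
     (\<exists>x\<in>W. \<exists>y\<in>W. d x c = h \<and> d y c = h \<and> d x y = 2 * h)"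

definition edge_centred :: "'a \<Rightarrow> 'a \<Rightarrow> nat \<Rightarrow> 'a set \<Rightarrow> bool" where
  "edge_centred c c' h W \<longleftrightarrow> c \<in> V \<and> c' \<in> V \<and> d c c' = 1 \<and> W \<subseteq> V \<and>
     (\<forall>w\<in>W. min (d w c) (d w c') \<le> h) \<and>
     (\<exists>x\<in>W. \<exists>y\<in>W. d x c = h \<and> d x c' = h + 1 \<and> d y c' = h \<and> d y c = h + 1)"

lemma edge_centred_swap:
  assumes "edge_centred c c' h W"
  shows "edge_centred c' c h W"
proof -
  have "d c' c = 1" using assms d_sym[of c c'] by (simp add: edge_centred_def)
  then show ?thesis using assms unfolding edge_centred_def by (metis min.commute)
qed

text \<open>
  A path between vertices on different sides of the edge \<open>cc'\<close> crosses it.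
\<close>

lemma through_edge:
  assumes "c \<in> V" "c' \<in> V" "d c c' = 1" "u \<in> V" "w \<in> V"
    and "d u c' = d u c + 1" "d w c = d w c' + 1"
  shows "d u w = d u c + 1 + d w c'"
proof -
  have "d c w = d c c' + d c' w" using assms d_sym by simp
  then show ?thesis using between_cases[of c w c' u] assms d_sym[of c' w] d_sym[of c' c] by auto
qed

text \<open>
  The path from \<open>u\<close> to at least one of the two antipodal points runs through the centre.
\<close>

lemma Max_dist_vertex_centred:
  assumes "vertex_centred c h W" "u \<in> V"
  shows "Max (d u ` W) = d u c + h"
proof (rule Max_eqI)
  have W: "W \<subseteq> V" "c \<in> V" using assms(1) by (auto simp: vertex_centred_def)
  show "finite (d u ` W)" using W finite_V finite_subset by blast
  show "m \<le> d u c + h" if "m \<in> d u ` W" for m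
  proof -
    from that obtain w where w: "w \<in> W" "m = d u w" by blast
    have "d u w \<le> d u c + d c w" using w W assms(2) d_tri by blast
    moreover have "d c w \<le> h" using assms(1) w W d_sym[of c w] by (auto simp: vertex_centred_def)
    ultimately show ?thesis using w by simp
  qed
  obtain x y where xy: "x \<in> W" "y \<in> W" "d x c = h" "d y c = h" "d x y = 2 * h"
    using assms(1) by (auto simp: vertex_centred_def)
  have xyV: "x \<in> V" "y \<in> V" using xy W by auto
  then have "d u x = d u c + d c x \<or> d u y = d u c + d c y"
    using between_cases[of x y c u] xy W assms(2) d_sym[of c y] by auto
  then have "d u c + h = d u x \<or> d u c + h = d u y"
    using xy xyV W d_sym[of c x] d_sym[of c y] by auto
  then show "d u c + h \<in> d u ` W" using xy by blast
qed

lemma edge_sides: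
  assumes "c \<in> V" "c' \<in> V" "d c c' = 1" "u \<in> V"
  obtains "d u c' = d u c + 1" | "d u c = d u c' + 1"
  using adj_cases[of c c' u] assms d_sym by metis

text \<open>
  The longest distance from \<open>u\<close> is the one to the antipodal point on the other side of the edge.
\<close>

lemma Max_dist_edge_centred:
  assumes "edge_centred c c' h W" "u \<in> V"
  shows "Max (d u ` W) = min (d u c) (d u c') + h + 1"
proof -
  have W: "W \<subseteq> V" and c: "c \<in> V" "c' \<in> V" "d c c' = 1" "d c' c = 1"
    using assms(1) d_sym[of c c'] by (auto simp: edge_centred_def)
  \<comment> \<open>By symmetry, it is enough to treat a vertex \<open>u\<close> on the side of \<open>a\<close>.\<close>
  have main: "Max (d u ` W) = d u a + h + 1"
    if "a \<in> V" "b \<in> V" "d a b = 1" "edge_centred a b h W" "d u b = d u a + 1" for a b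
  proof (rule Max_eqI)
    show "finite (d u ` W)" using W finite_V finite_subset by blast
    show "m \<le> d u a + h + 1" if "m \<in> d u ` W" for m
    proof -
      from that obtain w where w: "w \<in> W" "m = d u w" by blast
      then have h: "min (d w a) (d w b) \<le> h" using \<open>edge_centred a b h W\<close> by (auto simp: edge_centred_def)
      have "w \<in> V" using w W by blast
      then have "d u w \<le> d u a + d a w" "d u w \<le> d u b + d b w" "d a w = d w a" "d b w = d w b"
        using \<open>a \<in> V\<close> \<open>b \<in> V\<close> assms(2) d_tri d_sym by blast+
      then show ?thesis using h w \<open>d u b = d u a + 1\<close> by linarith
    qed
    obtain y where y: "y \<in> W" "d y b = h" "d y a = h + 1"
      using \<open>edge_centred a b h W\<close> by (auto simp: edge_centred_def)
    then have "d u y = d u a + 1 + h" using through_edge[of a b u y] that W assms(2) by auto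
    then show "d u a + h + 1 \<in> d u ` W" using y by force
  qed
  show ?thesis
  proof (cases rule: edge_sides[OF c(1,2,3) assms(2)])
    case 1
    then show ?thesis using main[of c c'] c assms(1) by simp
  next
    case 2
    then show ?thesis using main[of c' c] c edge_centred_swap[OF assms(1)] by simp
  qed
qed

text \<open>
  Let \<open>x\<close> and \<open>y\<close> be elements of \<open>W\<close> at maximal distance. An element of \<open>W\<close> too far from the midpoint
  of the path between them would be farther from one of \<open>x\<close> and \<open>y\<close> than they are from each other.
\<close>

lemma centred_cases:
  assumes "W \<subseteq> V" "W \<noteq> {}"
  obtains c h where "vertex_centred c h W" | c c' h where "edge_centred c c' h W"
proof -
  let ?D = "case_prod d ` (W \<times> W)"
  have fin: "finite W" using assms finite_V finite_subset by blast
  have "Max ?D \<in> ?D" using fin assms by (intro Max_in) auto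
  then obtain x y where xy: "x \<in> W" "y \<in> W" "Max ?D = d x y" by auto
  have max: "d v w \<le> d x y" if "v \<in> W" "w \<in> W" for v w
    using that fin xy(3)[symmetric] by (auto intro!: Max_ge)
  have V: "x \<in> V" "y \<in> V" using xy assms by auto
  define h where "h = d x y div 2"
  obtain c where c: "c \<in> V" "d x c = h" "d c y = d x y - h"
    using point_at[of x y h] V unfolding h_def by auto
  show ?thesis
  proof (cases "even (d x y)")
    case True
    then have h: "d x y = 2 * h" by (simp add: h_def)
    have "d w c \<le> h" if "w \<in> W" for w
    proof -
      have "w \<in> V" using that assms by auto
      then have "d w x = d w c + d c x \<or> d w y = d w c + d c y"
        using between_cases[of x y c w] V c h by auto
      moreover have "d c x = h" using c V d_sym by simp
      ultimately show ?thesis using max[OF that xy(1)] max[OF that xy(2)] c h by auto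
    qed
    then have "vertex_centred c h W"
      unfolding vertex_centred_def using c V xy h assms d_sym[of c y] by auto
    then show ?thesis using that by blast
  next
    case False
    then have h: "d x y = 2 * h + 1" by (simp add: h_def)
    then have "c \<noteq> y" using c V by auto
    then obtain b where b: "b \<in> V" "d c b = 1" "d c y = d b y + 1" using d_step c V by blast
    have bc: "d b c = 1" using b c d_sym by simp
    have "d x y \<le> d x b + d b y" "d x b \<le> d x c + d c b" using V b c d_tri by blast+
    then have xb: "d x b = h + 1" "d b y = h" using b c h by auto
    have yy: "d y c = h + 1" "d y b = h" using c b V xb h d_sym by auto
    have "min (d w c) (d w b) \<le> h" if "w \<in> W" for w
    proof (cases rule: edge_sides[OF c(1) b(1,2)])
      show "w \<in> V" using that assms by auto
      then show ?thesis if "d w b = d w c + 1"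
        using through_edge[of c b w y] b c V yy that max[OF \<open>w \<in> W\<close> xy(2)] h by auto
      show ?thesis if "d w c = d w b + 1"
        using through_edge[of b c w x] b bc c V xb that \<open>w \<in> V\<close> max[OF \<open>w \<in> W\<close> xy(1)] h by auto
    qed
    then have "edge_centred c b h W"
      unfolding edge_centred_def using c b V xb yy assms xy by auto
    then show ?thesis using that by blast
  qed
qed

lemma vertex_centred_level_eq:
  assumes "vertex_centred c h W" "u \<in> V" "v \<in> V" "rep u W = rep v W"
  shows "d u c = d v c"
proof -
  have "d u ` W = d v ` W" using assms by (intro rep_eq_image_eq) (auto simp: vertex_centred_def)
  then show ?thesis using Max_dist_vertex_centred assms by (metis add_right_cancel)
qed

text \<open>
  Equal representations give equal distances to the centre edge, with the two ends possibly exchanged.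
  In the latter case \<open>u\<close> and \<open>v\<close> lie on opposite sides of the edge and have different colours.
\<close>

lemma edge_centred_level_eq:
  assumes "edge_centred c c' h W" "u \<in> V" "v \<in> V" "rep u W = rep v W"
  shows "d u c = d v c \<and> d u c' = d v c' \<or>
    d u c = d v c' \<and> d u c' = d v c \<and> (even (d u c) \<longleftrightarrow> odd (d v c))"
proof -
  have "d u ` W = d v ` W" using assms by (intro rep_eq_image_eq) (auto simp: edge_centred_def)
  then have "min (d u c) (d u c') = min (d v c) (d v c')"
    using Max_dist_edge_centred assms by (metis add_right_cancel)
  moreover have "d u c' = d u c + 1 \<or> d u c = d u c' + 1" "d v c' = d v c + 1 \<or> d v c = d v c' + 1"
    using edge_sides assms by (metis edge_centred_def)+
  ultimately show ?thesis by (auto simp: min_def split: if_splits)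
qed

section \<open>Removing vertices from a resolving set\<close>

text \<open>
  Vertices that \<open>W - S\<close> does not distinguish are equally far from the centre. If this forces them to
  have equal representations by \<open>S\<close>, then \<open>W\<close> does not distinguish them either.
\<close>

lemma vertex_centred_remove:
  assumes "resolving W" "S \<subseteq> W" "vertex_centred c h (W - S)"
    and "\<And>u v. \<lbrakk>u \<in> V; v \<in> V; d u c = d v c\<rbrakk> \<Longrightarrow> rep u S = rep v S"
  shows "resolving (W - S)"
proof (rule resolving_transfer[OF assms(1)])
  have W: "W \<subseteq> V" using assms(1) by (simp add: resolving_def)
  then show "W - S \<subseteq> V" by auto
  fix u v assume "u \<in> V" "v \<in> V" "rep u (W - S) = rep v (W - S)"
  then have "rep u S = rep v S" using vertex_centred_level_eq assms by blast
  then show "rep u W = rep v W" using rep_split[OF W assms(2)] \<open>rep u (W - S) = rep v (W - S)\<close> by metis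
qed

lemma card_even_eq:
  assumes "W \<subseteq> V" "u \<in> V" "v \<in> V" "rep u W = rep v W"
  shows "card {w \<in> W. even (d u w)} = card {w \<in> W. even (d v w)}"
proof -
  have "size (filter_mset even (rep z W)) = card {w \<in> W. even (d z w)}" for z
    using assms(1) finite_V finite_subset[of W V]
    by (simp add: rep_def filter_mset_image_mset)
  then show ?thesis using assms(4) by metis
qed

text \<open>
  For \<open>u\<close> and \<open>v\<close> of different colours, the elements of \<open>W\<close> at even distance from \<open>u\<close> are those at odd
  distance from \<open>v\<close>. If \<open>u\<close> and \<open>v\<close> have the same representation, both kinds are equally many, and
  one of them consists of the elements of \<open>W\<close> of the colour of \<open>c\<close>.
\<close>

lemma balanced_if_opposite:
  assumes "W \<subseteq> V" "u \<in> V" "v \<in> V" "c \<in> V" "rep u W = rep v W" "even (d u c) \<longleftrightarrow> odd (d v c)"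
  shows "card W = 2 * card {w \<in> W. even (d c w)}"
proof -
  have fin: "finite W" using assms(1) finite_V finite_subset by blast
  have "card ({w \<in> W. even (d c w)} \<union> {w \<in> W. odd (d c w)})
      = card {w \<in> W. even (d c w)} + card {w \<in> W. odd (d c w)}"
    using fin by (intro card_Un_disjoint) auto
  moreover have "{w \<in> W. even (d c w)} \<union> {w \<in> W. odd (d c w)} = W" by auto
  ultimately have sum: "card W = card {w \<in> W. even (d c w)} + card {w \<in> W. odd (d c w)}" by simp
  have "{w \<in> W. even (d z w)} = (if even (d z c) then {w \<in> W. even (d c w)} else {w \<in> W. odd (d c w)})"
    if "z \<in> V" for z
  proof -
    have "even (d z w) \<longleftrightarrow> (even (d z c) \<longleftrightarrow> even (d c w))" if "w \<in> W" for w
      using even_d_iff[of z w c] assms(1,4) that \<open>z \<in> V\<close> by blast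
    then show ?thesis by auto
  qed
  then have "card {w \<in> W. even (d c w)} = card {w \<in> W. odd (d c w)}"
    using card_even_eq[OF assms(1,2,3,5)] assms(2,3,6) by (auto split: if_splits)
  then show ?thesis using sum by simp
qed

text \<open>
  Since the colour classes of \<open>W - S\<close> have different sizes, only vertices on the same side of the
  centre edge have to be considered, so \<open>S\<close> need not look the same from opposite sides.
\<close>

lemma edge_centred_remove:
  assumes "resolving W" "S \<subseteq> W" "edge_centred c c' h (W - S)"
    and "\<And>u v. \<lbrakk>u \<in> V; v \<in> V; d u c = d v c; d u c' = d v c'\<rbrakk> \<Longrightarrow> rep u S = rep v S"
    and "card (W - S) \<noteq> 2 * card {w \<in> W - S. even (d c w)}"
  shows "resolving (W - S)"
proof (rule resolving_transfer[OF assms(1)])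
  have W: "W \<subseteq> V" "c \<in> V" using assms(1,3) by (auto simp: resolving_def edge_centred_def)
  then show WS: "W - S \<subseteq> V" by auto
  fix u v assume uv: "u \<in> V" "v \<in> V" "rep u (W - S) = rep v (W - S)"
  then have "d u c = d v c \<and> d u c' = d v c'"
    using edge_centred_level_eq[OF assms(3)] balanced_if_opposite[OF WS _ _ W(2)] assms(5) by blast
  then have "rep u S = rep v S" using uv assms(4) by blast
  then show "rep u W = rep v W" using rep_split[OF W(1) assms(2)] uv by metis
qed

section \<open>Small resolving sets\<close>

lemma resolving_singleton:
  assumes "z \<in> V" "inj_on (\<lambda>u. d u z) V"
  shows "resolving {z}"
  using assms unfolding resolving_def inj_on_def by auto

text \<open>
  The distance to \<open>c\<close> can be read off from the representation by \<open>W - {c}\<close>, and it determines the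
  representation by the neighbours of \<open>c\<close>. So \<open>c\<close> is removed, and its neighbours as well if
  \<open>W - {c}\<close> consists of all vertices but \<open>c\<close>.
\<close>

lemma small_resolving_vertex_centred:
  assumes W: "resolving W" and cen: "vertex_centred c h W" and V3: "3 \<le> card V"
  shows "\<exists>W'. resolving W' \<and> card W' + 2 \<le> card V"
proof (cases "h = 0")
  case True
  then have "W \<subseteq> {c}" using cen d_eq_0 unfolding vertex_centred_def by blast
  then have "card W \<le> 1" using card_mono[of "{c}" W] by simp
  then show ?thesis using W V3 by (intro exI[of _ W]) simp
next
  case False
  have c: "c \<in> V" and WV: "W \<subseteq> V" using cen by (auto simp: vertex_centred_def)
  obtain x y where xy: "x \<in> W" "y \<in> W" "d x c = h" "d y c = h" "d x y = 2 * h"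
    using cen by (auto simp: vertex_centred_def)
  have xyV: "x \<in> V" "y \<in> V" "d c x = h" "d c y = h" "x \<noteq> c" "y \<noteq> c" "x \<noteq> y"
    using xy WV c False d_sym[of c x] d_sym[of c y] by auto
  have cen1: "vertex_centred c h (W - {c})"
    using cen xy xyV unfolding vertex_centred_def by (blast intro: xy)
  have W1: "resolving (W - {c})"
  proof -
    have "rep u (W \<inter> {c}) = rep v (W \<inter> {c})" if "d u c = d v c" for u v
      using that c by (intro rep_cong) auto
    moreover have "W - W \<inter> {c} = W - {c}" by auto
    ultimately show ?thesis
      using vertex_centred_remove[OF W, of "W \<inter> {c}" c h] cen1 by (metis Int_lower1)
  qed
  show ?thesis
  proof (cases "W - {c} = V - {c}")
    case False
    then have "W - {c} \<subset> V - {c}" using WV by auto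
    then have "card (W - {c}) < card (V - {c})" using finite_V by (intro psubset_card_mono) auto
    then show ?thesis using W1 c V3 by (intro exI[of _ "W - {c}"]) auto
  next
    case True
    \<comment> \<open>For \<open>h = 1\<close> the tree is a star with centre \<open>c\<close>, whose leaves all belong to \<open>W\<close>.\<close>
    have "h \<noteq> 1"
    proof
      assume "h = 1"
      have "d x w = d y w" if "w \<in> W - {c} - {x, y}" for w
      proof -
        have w: "w \<in> V" "w \<in> W" "w \<noteq> c" "x \<noteq> w" "y \<noteq> w" using that WV by auto
        have "d w c \<le> 1" using w cen \<open>h = 1\<close> by (auto simp: vertex_centred_def)
        moreover have "d w c \<noteq> 0" using w c d_eq_0 by auto
        ultimately have cw: "d c w = 1" "d c w = d w w + 1" using w c d_sym[of c w] by simp_all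
        have "d c x = 1" "d c y = 1" using xyV \<open>h = 1\<close> by simp_all
        then have "d x w = d c w + 1" "d y w = d c w + 1"
          using farther_if_not_closer[OF xyV(1) w(1) c w(1) _ cw(1) w(4) cw(2)]
            farther_if_not_closer[OF xyV(2) w(1) c w(1) _ cw(1) w(5) cw(2)] by blast+
        then show ?thesis by simp
      qed
      then have "\<not> resolving (W - {c})"
        using xy xyV WV by (intro twins_not_resolving[of _ x y]) auto
      then show False using W1 by blast
    qed
    then have h2: "2 \<le> h" using \<open>h \<noteq> 0\<close> by simp
    have nc: "nbrs c \<subseteq> W - {c}" unfolding True using c by (auto simp: nbrs_def)
    have "x \<notin> nbrs c" "y \<notin> nbrs c" using xyV h2 by (auto simp: nbrs_def)
    then have "vertex_centred c h (W - {c} - nbrs c)"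
      using cen1 xy xyV unfolding vertex_centred_def by (blast intro: xy)
    then have res: "resolving (W - {c} - nbrs c)"
      using rep_nbrs_eq[OF c] by (intro vertex_centred_remove[OF W1 nc])
    obtain a where a: "a \<in> nbrs c" using d_step[OF c xyV(1)] xyV by (auto simp: nbrs_def)
    then have "a \<in> V" "a \<noteq> c" using nc by (auto simp: nbrs_def)
    then have "card (V - {c, a}) + 2 = card V" using c finite_V V3 by (simp add: card_Diff_subset)
    moreover have "card (W - {c} - nbrs c) \<le> card (V - {c, a})"
      using a WV finite_V by (intro card_mono) auto
    ultimately show ?thesis using res by (intro exI[of _ "W - {c} - nbrs c"]) auto
  qed
qed

text \<open>
  Every element of \<open>W\<close> is \<open>p\<close>, a neighbour of \<open>p\<close>, or reached from \<open>p\<close> through \<open>q\<close>. Hence two neighbours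
  of \<open>p\<close> in \<open>W\<close> other than \<open>q\<close> have the same distance to all other elements of \<open>W\<close>.
\<close>

lemma unique_pendant_at_edge_centre:
  assumes W: "resolving W" and cen: "edge_centred p q 1 W"
    and ab: "a \<in> W" "b \<in> W" "d p a = 1" "d p b = 1" "a \<noteq> q" "b \<noteq> q"
  shows "a = b"
proof (rule ccontr)
  assume "a \<noteq> b"
  have V: "W \<subseteq> V" "p \<in> V" "q \<in> V" "d p q = 1" using cen by (auto simp: edge_centred_def)
  have abV: "a \<in> V" "b \<in> V" using ab V by auto
  have "d a w = d b w" if "w \<in> W - {a, b}" for w
  proof (cases "w = p")
    case True
    then show ?thesis using ab abV V d_sym by simp
  next
    case False
    have w: "w \<in> V" "w \<noteq> a" "w \<noteq> b" using that V by auto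
    have "d p w \<noteq> 0" using False w V d_eq_0 by auto
    moreover have "min (d w p) (d w q) \<le> 1" using cen that by (auto simp: edge_centred_def)
    ultimately have "d p w = 1 \<or> d p w \<noteq> 1 \<and> d q w \<le> 1"
      using d_sym[of w p] d_sym[of w q] w V by (auto simp: min_def split: if_splits)
    \<comment> \<open>The neighbour \<open>z\<close> of \<open>p\<close> closer to \<open>w\<close> is \<open>w\<close> or \<open>q\<close>, hence not \<open>a\<close> or \<open>b\<close>.\<close>
    then obtain z where "z \<in> V" "d p z = 1" "z \<noteq> a" "z \<noteq> b" "d p w = d z w + 1"
    proof
      assume "d p w = 1"
      then show thesis using that[of w] w by simp
    next
      assume "d p w \<noteq> 1 \<and> d q w \<le> 1"
      then have "d q w \<noteq> d p w + 1" using \<open>d p w \<noteq> 0\<close> by simp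
      then have "d p w = d q w + 1" using adj_cases[of p q w] V w by blast
      then show thesis using that[of q] V ab by auto
    qed
    then show ?thesis
      using farther_if_not_closer[of a z p w] farther_if_not_closer[of b z p w] abV ab V w by simp
  qed
  then show False using twins_not_resolving[of W a b] V ab \<open>a \<noteq> b\<close> W by blast
qed

text \<open>
  The candidates are \<open>W - {c'}\<close> and the smaller set \<open>W - nbrs c\<close>. They differ by neighbours of \<open>c\<close>,
  which are all of the colour opposite to \<open>c\<close>, so not both can have colour classes of equal size.
  The neighbours of \<open>c\<close> may be removed only if the antipodal points \<open>x\<close> and \<open>y\<close> are not among them.
  For \<open>h = 1\<close> this fails; then the tree is the path \<open>x, c, c', y\<close>.
\<close>

lemma small_resolving_missing_centre:
  assumes W: "resolving W" and cen: "edge_centred c c' h W" and h: "h \<noteq> 0"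
    and Weq: "W = V - {c}" and V3: "3 \<le> card V"
  shows "\<exists>W'. resolving W' \<and> card W' + 2 \<le> card V"
proof -
  have V: "c \<in> V" "c' \<in> V" "d c c' = 1" "d c' c = 1" "c' \<noteq> c"
    using cen d_sym[of c c'] d_self[of c] by (auto simp: edge_centred_def)
  obtain x y where xy: "x \<in> W" "y \<in> W" "d x c = h" "d x c' = h + 1" "d y c' = h" "d y c = h + 1"
    using cen by (auto simp: edge_centred_def)
  have xyV: "x \<in> V" "y \<in> V" "x \<noteq> c" "y \<noteq> c" "x \<noteq> c'" "y \<noteq> c'"
      "d c x = h" "d c' x = h + 1" "d c' y = h" "d c y = h + 1"
    using xy V Weq h d_sym by auto
  show ?thesis
  proof (cases "h = 1")
    case True
    have "w \<in> {x, y, c, c'}" if "w \<in> V" for w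
    proof (rule ccontr)
      assume w: "w \<notin> {x, y, c, c'}"
      then have wW: "w \<in> W" using that Weq by auto
      have "d w c \<noteq> 0" "d w c' \<noteq> 0" using w that V d_eq_0 by auto
      moreover have "min (d w c) (d w c') \<le> 1" using cen wW True by (auto simp: edge_centred_def)
      ultimately have "d c w = 1 \<or> d c' w = 1"
        using d_sym[of w c] d_sym[of w c'] that V by (auto simp: min_def split: if_splits)
      then show False
        using unique_pendant_at_edge_centre[OF W, of c c' w x]
          unique_pendant_at_edge_centre[OF W, of c' c w y] edge_centred_swap cen w wW xy xyV True
        by auto
    qed
    then have sub: "V \<subseteq> {x, y, c, c'}" by blast
    have "d x y = 3" using through_edge[of c c' x y] V xyV xy True by simp
    then have "inj_on (\<lambda>u. d u y) {x, y, c, c'}" using xyV True by (auto simp: inj_on_def)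
    then have "resolving {y}" using inj_on_subset[OF _ sub] xyV(2) by (intro resolving_singleton)
    then show ?thesis using V3 by (intro exI[of _ "{y}"]) simp
  next
    case False
    let ?U = "W - {c'}" and ?U' = "W - nbrs c"
    have sub: "nbrs c \<subseteq> W" using Weq V by (auto simp: nbrs_def)
    have c'n: "c' \<in> nbrs c" using V by (simp add: nbrs_def)
    have xyn: "x \<notin> nbrs c" "y \<notin> nbrs c" using xyV False h by (auto simp: nbrs_def)
    have cenU: "edge_centred c c' h ?U" "edge_centred c c' h ?U'"
      using cen xy xyV xyn unfolding edge_centred_def by (blast intro: xy)+
    have cardU: "card ?U + 2 = card V" using Weq V finite_V V3 by (simp add: card_Diff_subset)
    have fin: "finite W" using Weq finite_V by simp
    show ?thesis
    proof (cases "card ?U = 2 * card {w \<in> ?U. even (d c w)}")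
      case False
      have "resolving ?U"
        using cenU(1) False sub c'n by (intro edge_centred_remove[OF W _ cenU(1)]) auto
      then show ?thesis using cardU by auto
    next
      case True
      obtain a where a: "a \<in> V" "d c a = 1" "d c x = d a x + 1" using d_step V xyV by metis
      have "a \<noteq> c'" using a xyV by auto
      moreover have "a \<in> nbrs c" using a by (simp add: nbrs_def)
      ultimately have "?U' \<subset> ?U" using c'n sub by auto
      then have less: "card ?U' < card ?U" using fin by (intro psubset_card_mono) auto
      have "{w \<in> ?U'. even (d c w)} = {w \<in> ?U. even (d c w)}"
        using c'n V by (auto simp: nbrs_def)
      then have "card ?U' \<noteq> 2 * card {w \<in> ?U'. even (d c w)}" using True less by simp
      then have "resolving ?U'"
        using rep_nbrs_eq[OF V(1)] by (intro edge_centred_remove[OF W sub cenU(2)])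
      then show ?thesis using cardU less by (intro exI[of _ ?U']) simp
    qed
  qed
qed

text \<open>
  From opposite sides of the edge, the two vertices \<open>c\<close> and \<open>c'\<close> exchange their distances, so that
  together they give the same representation. This is why both can be removed without any condition
  on the colours.
\<close>

lemma small_resolving_edge_centred:
  assumes W: "resolving W" and cen: "edge_centred c c' h W" and V3: "3 \<le> card V"
  shows "\<exists>W'. resolving W' \<and> card W' + 2 \<le> card V"
proof -
  have V: "c \<in> V" "c' \<in> V" "d c c' = 1" "c' \<noteq> c" "W \<subseteq> V"
    using cen d_self[of c] by (auto simp: edge_centred_def)
  have fin: "finite W" using V finite_V finite_subset by blast
  consider "card W + 2 \<le> card V" | "card V < card W + 2" "h = 0" | "h \<noteq> 0" "c \<in> W" "c' \<in> W"
    | "card V < card W + 2" "h \<noteq> 0" "c \<notin> W" | "card V < card W + 2" "h \<noteq> 0" "c' \<notin> W"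
    by linarith
  then show ?thesis
  proof cases
    case 1
    then show ?thesis using W by blast
  next
    case 2
    have "w \<in> {c, c'}" if "w \<in> W" for w
    proof -
      have "min (d w c) (d w c') = 0" using cen that 2 by (auto simp: edge_centred_def)
      then show ?thesis using that V d_eq_0[of w c] d_eq_0[of w c'] by (auto simp: min_def split: if_splits)
    qed
    \<comment> \<open>As \<open>W\<close> misses at most one vertex, the tree is the edge extended by one vertex \<open>z\<close>: a path.\<close>
    then have "card W \<le> card {c, c'}" by (intro card_mono) auto
    then have "card V = 3" using V 2 V3 by simp
    then have "card (V - {c, c'}) = 1" using V finite_V by (simp add: card_Diff_subset)
    then obtain z where z: "V - {c, c'} = {z}" by (auto simp: card_1_singleton_iff)
    then have Veq: "V = {c, c', z}" and zV: "z \<in> V" "z \<noteq> c" "z \<noteq> c'" using V by auto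
    have "d c z \<noteq> 0" "d c' z \<noteq> 0" "d c z \<noteq> d c' z" using V zV d_eq_0 adj_neq by auto
    then have "inj_on (\<lambda>u. d u z) V" using zV d_self[of z] unfolding Veq by (auto simp: inj_on_def)
    then have "resolving {z}" using zV by (intro resolving_singleton)
    then show ?thesis using V3 by (intro exI[of _ "{z}"]) simp
  next
    case 3
    let ?U = "W - {c, c'}"
    have cenU: "edge_centred c c' h ?U"
    proof -
      obtain x y where xy: "x \<in> W" "y \<in> W" "d x c = h" "d x c' = h + 1" "d y c' = h" "d y c = h + 1"
        using cen by (auto simp: edge_centred_def)
      moreover have "x \<noteq> c" "x \<noteq> c'" "y \<noteq> c" "y \<noteq> c'" using xy V 3 by auto
      ultimately show ?thesis using cen unfolding edge_centred_def by blast
    qed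
    have "resolving ?U"
    proof (rule resolving_transfer[OF W])
      fix u v assume uv: "u \<in> V" "v \<in> V" "rep u ?U = rep v ?U"
      have two: "rep z {c, c'} = {#d z c, d z c'#}" for z
        using rep_insert[of c "{c'}"] V by simp
      have "rep u {c, c'} = rep v {c, c'}"
        using edge_centred_level_eq[OF cenU uv] unfolding two by (auto simp: add_mset_commute)
      moreover have "rep u W = rep u ?U + rep u {c, c'}" "rep v W = rep v ?U + rep v {c, c'}"
        using 3 V by (auto intro!: rep_split)
      ultimately show "rep u W = rep v W" using uv by simp
    qed (use V in auto)
    moreover have "card ?U + 2 = card W"
      using 3 V fin card_mono[of W "{c, c'}"] by (simp add: card_Diff_subset)
    ultimately show ?thesis using card_mono[OF finite_V V(5)] by (intro exI[of _ ?U]) simp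
  next
    case 4
    have "W = V - {c}"
      using 4 V finite_V by (intro card_seteq) auto
    then show ?thesis using small_resolving_missing_centre[OF W cen 4(2) _ V3] by blast
  next
    case 5
    have "W = V - {c'}"
      using 5 V finite_V by (intro card_seteq) auto
    then show ?thesis
      using small_resolving_missing_centre[OF W edge_centred_swap[OF cen] 5(2) _ V3] by blast
  qed
qed

lemma small_resolving:
  assumes "resolving W" "3 \<le> card V"
  shows "\<exists>W'. resolving W' \<and> card W' + 2 \<le> card V"
proof (cases "W = {}")
  case True
  then show ?thesis using assms by (intro exI[of _ W]) simp
next
  case False
  have "W \<subseteq> V" using assms(1) by (simp add: resolving_def)
  then show ?thesis
    using centred_cases[OF _ False] small_resolving_vertex_centred small_resolving_edge_centred assms
    by metis
qed

end

section \<open>Distances in graph-theoretic trees\<close>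

lemma gdist_le_awalk:
  assumes "pair_graph G" "pre_digraph.awalk (with_proj G) u p v"
  shows "gdist G u v \<le> length p"
proof -
  interpret pair_graph G by fact
  have "\<exists>q. apath u q v \<and> length q \<le> length p"
    using assms(2)
  proof (induction rule: awalk_to_apath_induct)
    case (path p)
    then show ?case by (intro exI[of _ p]) (simp add: apath_def)
  next
    case (decomp p q r s)
    obtain q' where q': "apath u q' v" "length q' \<le> length (q @ s)" using decomp.IH by blast
    have "p = q @ r @ s" using awalk_cyc_decompE[OF decomp(2,1,3)] by blast
    then show ?case using q' by (intro exI[of _ q']) simp
  qed
  then obtain q where q: "apath u q v" "length q \<le> length p" by blast
  have "gdist G u v \<le> length q" unfolding gdist_def using q(1) by (intro Least_le) blast
  then show ?thesis using q(2) by simp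
qed

lemma gdist_apath:
  assumes "graph_tree G" "u \<in> pverts G" "v \<in> pverts G"
  obtains p where "pre_digraph.apath (with_proj G) u p v" "length p = gdist G u v"
proof -
  interpret pair_graph G using assms by (simp add: graph_tree_def)
  have "strongly_connected (with_proj G)"
    using assms(1) pair_sym_arcs
    by (intro symmetric_connected_imp_strongly_connected) (auto simp: graph_tree_def)
  then have "reachable (with_proj G) u v" using assms by auto
  then have "\<exists>k. \<exists>p. apath u p v \<and> length p = k" by (simp add: reachable_apath)
  from LeastI_ex[OF this] show ?thesis using that unfolding gdist_def by blast
qed

lemma gdist_adjacent_iff:
  assumes "graph_tree G" "u \<in> pverts G" "v \<in> pverts G"
  shows "gdist G u v = 1 \<longleftrightarrow> (u, v) \<in> parcs G"
proof -
  interpret pair_graph G using assms by (simp add: graph_tree_def)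
  obtain p where p: "apath u p v" "length p = gdist G u v" by (rule gdist_apath[OF assms])
  show ?thesis
  proof
    assume "gdist G u v = 1"
    then obtain e where "p = [e]" using p(2) by (auto simp: length_Suc_conv)
    then show "(u, v) \<in> parcs G" using p(1) by (cases e) (auto simp: apath_simps)
  next
    assume e: "(u, v) \<in> parcs G"
    then have "awalk u [(u, v)] v" using assms by (auto simp: awalk_simps)
    from gdist_le_awalk[OF pair_graph this] have "gdist G u v \<le> 1" by simp
    moreover have "p \<noteq> []" using e p(1) pair_no_loops[OF e] by (auto simp: apath_simps)
    ultimately show "gdist G u v = 1" using p(2) by (cases p) auto
  qed
qed

text \<open>
  A walk from \<open>a\<close> to \<open>b\<close> avoiding the arc \<open>(a, b)\<close> contains a path that avoids it too. This path has
  at least two arcs, so that the arc \<open>(b, a)\<close> closes it to a cycle of length at least 3.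
\<close>

lemma tree_no_detour:
  assumes "graph_tree G" "(a, b) \<in> parcs G"
  shows "(a, b) \<notin> (parcs G - {(a, b)})\<^sup>*"
proof
  interpret pair_graph G using assms by (simp add: graph_tree_def)
  have V: "a \<in> pverts G" "b \<in> pverts G" using assms(2) wellformed' by auto
  have walk: "\<exists>p. awalk a p c \<and> (a, b) \<notin> set p" if "(a, c) \<in> (parcs G - {(a, b)})\<^sup>*" for c
    using that
  proof (induction rule: rtrancl_induct)
    case base
    then show ?case using V by (intro exI[of _ "[]"]) (auto simp: awalk_simps)
  next
    case (step y z)
    then obtain p where "awalk a p y" "(a, b) \<notin> set p" by blast
    moreover have "awalk y [(y, z)] z" using step wellformed' by (auto simp: awalk_simps)
    ultimately show ?case using step by (intro exI[of _ "p @ [(y, z)]"]) auto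
  qed
  assume "(a, b) \<in> (parcs G - {(a, b)})\<^sup>*"
  then obtain p where p: "apath a p b" "(a, b) \<notin> set p"
    using walk apath_awalk_to_apath awalk_to_apath_subset by blast
  have "a \<noteq> b" using pair_no_loops[OF assms(2)] by simp
  have "2 \<le> length p"
  proof (rule ccontr)
    assume "\<not> 2 \<le> length p"
    then consider "p = []" | e where "p = [e]" by (cases p; cases "tl p") auto
    then show False
    proof cases
      case 1
      then show False using p \<open>a \<noteq> b\<close> by (auto simp: apath_simps)
    next
      case 2
      then show False using p by (cases e) (auto simp: apath_simps)
    qed
  qed
  have ba: "(b, a) \<in> parcs G" using assms(2) arcs_symmetric by blast
  have aw: "awalk b ((b, a) # p) b" using p(1) ba V by (auto simp: awalk_simps apath_def)
  moreover have "distinct (tl (awalk_verts b ((b, a) # p)))"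
    using p(1) by (auto simp: apath_def)
  ultimately have "cycle ((b, a) # p)" unfolding cycle_def by blast
  moreover have "3 \<le> length ((b, a) # p)" using \<open>2 \<le> length p\<close> by simp
  ultimately show False using assms(1) unfolding graph_tree_def by blast
qed

lemma length_rev_path [simp]: "length (rev_path p) = length p"
  by (induction p) auto

lemma gdist_sym:
  assumes "graph_tree G" "u \<in> pverts G" "v \<in> pverts G"
  shows "gdist G u v = gdist G v u"
proof -
  interpret pair_graph G using assms by (simp add: graph_tree_def)
  have le: "gdist G b a \<le> gdist G a b" if ab: "a \<in> pverts G" "b \<in> pverts G" for a b
  proof -
    obtain p where p: "apath a p b" "length p = gdist G a b" by (rule gdist_apath[OF assms(1) ab])
    then have "awalk b (rev_path p) a" by (simp add: apath_def)
    from gdist_le_awalk[OF pair_graph this] show ?thesis using p(2) by simp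
  qed
  show ?thesis using le[OF assms(2,3)] le[OF assms(3,2)] by simp
qed

lemma gdist_eq_0_iff:
  assumes "graph_tree G" "u \<in> pverts G" "v \<in> pverts G"
  shows "gdist G u v = 0 \<longleftrightarrow> u = v"
proof -
  interpret pair_graph G using assms by (simp add: graph_tree_def)
  obtain p where p: "apath u p v" "length p = gdist G u v" by (rule gdist_apath[OF assms])
  show ?thesis
  proof
    assume "gdist G u v = 0"
    then show "u = v" using p by (simp add: apath_simps)
  next
    assume "u = v"
    then have "awalk u [] v" using assms by (simp add: awalk_simps)
    from gdist_le_awalk[OF pair_graph this] show "gdist G u v = 0" by simp
  qed
qed

lemma gdist_triangle:
  assumes "graph_tree G" "u \<in> pverts G" "v \<in> pverts G" "w \<in> pverts G"
  shows "gdist G u w \<le> gdist G u v + gdist G v w"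
proof -
  interpret pair_graph G using assms by (simp add: graph_tree_def)
  obtain p where p: "apath u p v" "length p = gdist G u v" by (rule gdist_apath[OF assms(1-3)])
  obtain q where q: "apath v q w" "length q = gdist G v w" by (rule gdist_apath[OF assms(1,3,4)])
  have "awalk u (p @ q) w" using p q by (auto simp: apath_def)
  from gdist_le_awalk[OF pair_graph this] show ?thesis using p q by simp
qed

lemma gdist_step:
  assumes "graph_tree G" "u \<in> pverts G" "v \<in> pverts G" "u \<noteq> v"
  shows "\<exists>a\<in>pverts G. gdist G u a = 1 \<and> gdist G u v = gdist G a v + 1"
proof -
  interpret pair_graph G using assms by (simp add: graph_tree_def)
  obtain p where p: "apath u p v" "length p = gdist G u v" by (rule gdist_apath[OF assms(1-3)])
  obtain e q where eq: "p = e # q" using p assms(4) by (cases p) (auto simp: apath_simps)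
  obtain a where a: "(u, a) \<in> parcs G" "apath a q v"
    using p(1) unfolding eq by (cases e) (auto simp: apath_simps)
  have aV: "a \<in> pverts G" using a(1) wellformed' by blast
  have ua: "gdist G u a = 1" using gdist_adjacent_iff[OF assms(1,2) aV] a by simp
  have "awalk a q v" using a by (simp add: apath_def)
  from gdist_le_awalk[OF pair_graph this] have "gdist G a v + 1 \<le> gdist G u v" using p eq by simp
  moreover have "gdist G u v \<le> gdist G u a + gdist G a v"
    by (rule gdist_triangle[OF assms(1,2) aV assms(3)])
  ultimately show ?thesis using ua aV by (intro bexI[of _ a]) auto
qed

text \<open>
  The last two assumptions of \<open>tree_metric\<close> follow by exhibiting a detour around an arc. The
  detours go through \<open>u\<close> along shortest paths; the conditions on the distances to \<open>u\<close> record which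
  arcs such paths cannot use.
\<close>

definition level_arcs :: "'a pair_pre_digraph \<Rightarrow> 'a \<Rightarrow> nat \<Rightarrow> ('a \<times> 'a) set" where
  "level_arcs G u m = {(s, t) \<in> parcs G.
     gdist G s u \<noteq> gdist G t u \<and> gdist G s u \<le> m \<and> gdist G t u \<le> m}"

lemma level_arcs_connected:
  assumes "graph_tree G" "u \<in> pverts G"
    and "v \<in> pverts G" "gdist G v u \<le> m" "w \<in> pverts G" "gdist G w u \<le> m"
  shows "(v, w) \<in> (level_arcs G u m)\<^sup>*"
proof -
  interpret pair_graph G using assms by (simp add: graph_tree_def)
  have root: "(z, u) \<in> (level_arcs G u m)\<^sup>*" if "z \<in> pverts G" "gdist G z u \<le> m" for z
    using that
  proof (induction "gdist G z u" arbitrary: z)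
    case 0
    then show ?case using gdist_eq_0_iff[OF assms(1) _ assms(2)] by auto
  next
    case (Suc k)
    then have "z \<noteq> u" using gdist_eq_0_iff[OF assms(1,2,2)] by auto
    then obtain a where a: "a \<in> pverts G" "gdist G z a = 1" "gdist G z u = gdist G a u + 1"
      using gdist_step[OF assms(1) Suc.prems(1) assms(2)] by blast
    then have "(z, a) \<in> parcs G" using gdist_adjacent_iff[OF assms(1) Suc.prems(1)] by blast
    then have "(z, a) \<in> level_arcs G u m" using a Suc.prems by (auto simp: level_arcs_def)
    moreover have "(a, u) \<in> (level_arcs G u m)\<^sup>*" using Suc a by auto
    ultimately show ?case by (rule converse_rtrancl_into_rtrancl)
  qed
  have "sym (level_arcs G u m)"
    using arcs_symmetric by (auto simp: level_arcs_def sym_def)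
  then have "sym ((level_arcs G u m)\<^sup>*)" by (rule sym_rtrancl)
  then have "(u, w) \<in> (level_arcs G u m)\<^sup>*" using root[OF assms(5,6)] by (auto dest: symD)
  then show ?thesis using root[OF assms(3,4)] by (rule rtrancl_trans[rotated])
qed

lemma tree_adjacent_levels:
  assumes "graph_tree G" "u \<in> pverts G" "(a, b) \<in> parcs G"
  shows "gdist G a u \<noteq> gdist G b u"
proof
  interpret pair_graph G using assms by (simp add: graph_tree_def)
  assume eq: "gdist G a u = gdist G b u"
  have "(a, b) \<in> (level_arcs G u (gdist G a u))\<^sup>*"
    using level_arcs_connected[OF assms(1,2)] assms(3) eq wellformed' by simp
  moreover have "level_arcs G u (gdist G a u) \<subseteq> parcs G - {(a, b)}"
    using eq by (auto simp: level_arcs_def)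
  ultimately show False using tree_no_detour[OF assms(1,3)] rtrancl_mono by blast
qed

lemma tree_closer_neighbour_unique:
  assumes "graph_tree G" "u \<in> pverts G" "(c, a) \<in> parcs G" "(c, b) \<in> parcs G"
    and "gdist G c u = gdist G a u + 1" "gdist G c u = gdist G b u + 1"
  shows "a = b"
proof (rule ccontr)
  interpret pair_graph G using assms by (simp add: graph_tree_def)
  assume "a \<noteq> b"
  have "(a, b) \<in> (level_arcs G u (gdist G a u))\<^sup>*"
    using level_arcs_connected[OF assms(1,2)] assms wellformed' by simp
  moreover have "level_arcs G u (gdist G a u) \<subseteq> parcs G - {(c, b)}"
    using assms(5) by (auto simp: level_arcs_def)
  ultimately have "(a, b) \<in> (parcs G - {(c, b)})\<^sup>*" using rtrancl_mono by blast
  moreover have "(c, a) \<in> parcs G - {(c, b)}" using assms(3) \<open>a \<noteq> b\<close> by simp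
  ultimately have "(c, b) \<in> (parcs G - {(c, b)})\<^sup>*" by (rule converse_rtrancl_into_rtrancl[rotated])
  then show False using tree_no_detour[OF assms(1,4)] by blast
qed

lemma tree_metric_gdist:
  assumes "graph_tree G"
  shows "tree_metric (pverts G) (gdist G)"
proof -
  interpret pair_graph G using assms by (simp add: graph_tree_def)
  show ?thesis
  proof
    show "finite (pverts G)" by (rule pair_finite_verts)
  next
    fix a b u
    assume "a \<in> pverts G" "b \<in> pverts G" "u \<in> pverts G" "gdist G a b = 1"
    then show "gdist G a u \<noteq> gdist G b u"
      using tree_adjacent_levels[OF assms] gdist_adjacent_iff[OF assms] by blast
  next
    fix a b c u
    assume "a \<in> pverts G" "b \<in> pverts G" "c \<in> pverts G" "u \<in> pverts G"
      "gdist G c a = 1" "gdist G c b = 1"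
      "gdist G c u = gdist G a u + 1" "gdist G c u = gdist G b u + 1"
    then show "a = b"
      using tree_closer_neighbour_unique[OF assms] gdist_adjacent_iff[OF assms] by blast
  qed (fact gdist_eq_0_iff[OF assms] gdist_sym[OF assms] gdist_triangle[OF assms] gdist_step[OF assms])+
qed

lemma card_ge_3_if_diameter_ge_2:
  assumes "graph_tree G" "2 \<le> diameter G"
  shows "3 \<le> card (pverts G)"
proof -
  interpret pair_graph G using assms by (simp add: graph_tree_def)
  let ?D = "{gdist G u v |u v. u \<in> pverts G \<and> v \<in> pverts G}"
  have D: "?D = (\<lambda>(u, v). gdist G u v) ` (pverts G \<times> pverts G)" by auto
  have "pverts G \<noteq> {}"
    using assms(1) by (auto simp: graph_tree_def connected_def strongly_connected_def)
  then have "Max ?D \<in> ?D" unfolding D using pair_finite_verts by (intro Max_in) auto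
  then obtain u v where uv: "u \<in> pverts G" "v \<in> pverts G" "2 \<le> gdist G u v"
    using assms(2) unfolding diameter_def by auto
  then have "u \<noteq> v" using gdist_eq_0_iff[OF assms(1) uv(1,1)] by auto
  then obtain a where a: "a \<in> pverts G" "gdist G u a = 1" "gdist G u v = gdist G a v + 1"
    using gdist_step[OF assms(1) uv(1,2)] by blast
  have "a \<noteq> u" using a gdist_eq_0_iff[OF assms(1) uv(1,1)] by auto
  moreover have "a \<noteq> v" using a uv(3) by auto
  ultimately have "card {u, a, v} = 3" using \<open>u \<noteq> v\<close> by simp
  then show ?thesis
    using card_mono[OF pair_finite_verts, of "{u, a, v}"] uv a by simp
qed

theorem theorem1:
  fixes T :: "'a pair_pre_digraph" and n :: nat
  assumes "graph_tree T"
    and "card (pverts T) = n"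
    and "diameter T \<ge> 2"
    and "multiset_dim T < \<infinity>"
  shows "multiset_dim T \<le> enat (n - 2)"
proof -
  interpret tree_metric "pverts T" "gdist T" using assms(1) by (rule tree_metric_gdist)
  have res: "m_resolving T W \<longleftrightarrow> resolving W" for W
    unfolding m_resolving_def resolving_def rep_mset_def rep_def by blast
  have "\<exists>W. m_resolving T W"
  proof (rule ccontr)
    assume "\<not> (\<exists>W. m_resolving T W)"
    then have "multiset_dim T = \<infinity>" unfolding multiset_dim_def by (rule if_not_P)
    then show False using assms(4) by simp
  qed
  then obtain W where "m_resolving T W" "card W + 2 \<le> n"
    using small_resolving card_ge_3_if_diameter_ge_2[OF assms(1,3)] assms(2) unfolding res by blast
  moreover from this have "(LEAST k. \<exists>W. m_resolving T W \<and> card W = k) \<le> card W"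
    by (intro Least_le) blast
  ultimately show ?thesis unfolding multiset_dim_def by auto
qed

end
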